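(* Let $D\subset\mathbb{R}^d$ be compact, let $g,\tilde g:D\to\mathbb{R}$ with $g$ continuous, let $\boldsymbol{u}_1,\dots,\boldsymbol{u}_n\in D$ be distinct points, and set $\boldsymbol{g}=(g(\boldsymbol{u}_1),\dots,g(\boldsymbol{u}_n))^{\intercal}$, $\tilde{\boldsymbol{g}}=(\tilde g(\boldsymbol{u}_1),\dots,\tilde g(\boldsymbol{u}_n))^{\intercal}$. Let $P_g^{\tilde g}$ and $P_{\tilde g}^{\tilde g}$ be the variably scaled kernel interpolants, with scaling function $\tilde g$, of the data $\boldsymbol{g}$ and $\tilde{\boldsymbol{g}}$ respectively, and let $\lambda$ be the associated Lebesgue function. Then, for every $\boldsymbol{u}\in D$, $$\big|(g-P_g^{\tilde g})(\boldsymbol{u})\big|\le \|g-P_{\tilde g}^{\tilde g}\|_{\infty}+\|\tilde{\boldsymbol{g}}-\boldsymbol{g}\|_{\infty}\,\lambda(\boldsymbol{u}).$$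
   Context: Let $\kappa$ be a strictly positive definite radial kernel on $\mathbb{R}^{d+1}$. For $h:D\to\mathbb{R}$, the variably scaled kernel (VSK) interpolant of $h$ with scaling function $\tilde g$ is $$P_h^{\tilde g}(\boldsymbol{u})=\sum_{i=1}^n c_i\,\kappa\big((\boldsymbol{u}_i,\tilde g(\boldsymbol{u}_i)),(\boldsymbol{u},\tilde g(\boldsymbol{u}))\big),\qquad \boldsymbol{u}\in D,$$ where $\mathsf{K}\boldsymbol{c}=(h(\boldsymbol{u}_1),\dots,h(\boldsymbol{u}_n))^{\intercal}$ and $\mathsf{K}_{ij}=\kappa((\boldsymbol{u}_i,\tilde g(\boldsymbol{u}_i)),(\boldsymbol{u}_j,\tilde g(\boldsymbol{u}_j)))$. The cardinal (Lagrange) functions $\varphi_1,\dots,\varphi_n$ are the elements of the span of the functions $\boldsymbol{u}\mapsto\kappa((\boldsymbol{u}_j,\tilde g(\boldsymbol{u}_j)),(\boldsymbol{u},\tilde g(\boldsymbol{u})))$, $j=1,\dots,n$, such that $P_h^{\tilde g}=\sum_{j=1}^n h(\boldsymbol{u}_j)\varphi_j$ for all $h$. The Lebesgue function is $\lambda(\boldsymbol{u})=\sum_{j=1}^n|\varphi_j(\boldsymbol{u})|$. For functions, $\|\cdot\|_\infty$ is the supremum norm on $D$; for vectors it is the maximum norm. *)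

theory Defs
  imports "HOL-Analysis.Analysis"
begin

(* Points of R^(d+1) are pairs in (real ^ 'd) \<times> real; the norm of the product type is the
   Euclidean norm of R^(d+1). *)

definition radial_kernel :: "('a::real_normed_vector \<Rightarrow> 'a \<Rightarrow> real) \<Rightarrow> bool" where
  "radial_kernel \<kappa> \<longleftrightarrow> (\<exists>\<phi>::real \<Rightarrow> real. \<forall>x y. \<kappa> x y = \<phi> (norm (x - y)))"

definition strictly_positive_definite :: "('a \<Rightarrow> 'a \<Rightarrow> real) \<Rightarrow> bool" where
  "strictly_positive_definite \<kappa> \<longleftrightarrow>
     (\<forall>x y. \<kappa> x y = \<kappa> y x) \<and>
     (\<forall>X c. finite X \<longrightarrow> (\<exists>x\<in>X. c x \<noteq> (0::real)) \<longrightarrow>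
        (\<Sum>x\<in>X. \<Sum>y\<in>X. c x * c y * \<kappa> x y) > 0)"

(* Below, s is the scaling function and p the family of nodes, indexed by a finite type 'n.
   Functions on D are total functions; only their values on D matter. *)

definition vsk_basis ::
  "((real^'d) \<times> real \<Rightarrow> (real^'d) \<times> real \<Rightarrow> real) \<Rightarrow> (real^'d \<Rightarrow> real) \<Rightarrow> ('n \<Rightarrow> real^'d) \<Rightarrow>
     'n \<Rightarrow> real^'d \<Rightarrow> real" where
  "vsk_basis \<kappa> s p i u = \<kappa> (p i, s (p i)) (u, s u)"

definition vsk_matrix ::
  "((real^'d) \<times> real \<Rightarrow> (real^'d) \<times> real \<Rightarrow> real) \<Rightarrow> (real^'d \<Rightarrow> real) \<Rightarrow> ('n::finite \<Rightarrow> real^'d) \<Rightarrow>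
     real^'n^'n" where
  "vsk_matrix \<kappa> s p = (\<chi> i j. \<kappa> (p i, s (p i)) (p j, s (p j)))"

(* The solution exists and is unique for strictly positive definite \<kappa> and distinct nodes. *)
definition vsk_coeffs ::
  "((real^'d) \<times> real \<Rightarrow> (real^'d) \<times> real \<Rightarrow> real) \<Rightarrow> (real^'d \<Rightarrow> real) \<Rightarrow> ('n::finite \<Rightarrow> real^'d) \<Rightarrow>
     (real^'d \<Rightarrow> real) \<Rightarrow> real^'n" where
  "vsk_coeffs \<kappa> s p h = (THE c. vsk_matrix \<kappa> s p *v c = (\<chi> i. h (p i)))"

definition vsk_interpolant ::
  "((real^'d) \<times> real \<Rightarrow> (real^'d) \<times> real \<Rightarrow> real) \<Rightarrow> (real^'d \<Rightarrow> real) \<Rightarrow> ('n::finite \<Rightarrow> real^'d) \<Rightarrow>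
     (real^'d \<Rightarrow> real) \<Rightarrow> real^'d \<Rightarrow> real" where
  "vsk_interpolant \<kappa> s p h u = (\<Sum>i\<in>UNIV. vsk_coeffs \<kappa> s p h $ i * vsk_basis \<kappa> s p i u)"

definition vsk_span ::
  "((real^'d) \<times> real \<Rightarrow> (real^'d) \<times> real \<Rightarrow> real) \<Rightarrow> (real^'d \<Rightarrow> real) \<Rightarrow> ('n::finite \<Rightarrow> real^'d) \<Rightarrow>
     (real^'d \<Rightarrow> real) set" where
  "vsk_span \<kappa> s p = range (\<lambda>a u. \<Sum>j\<in>UNIV. a j * vsk_basis \<kappa> s p j u)"

definition is_cardinal_family ::
  "(real^'d) set \<Rightarrow> ((real^'d) \<times> real \<Rightarrow> (real^'d) \<times> real \<Rightarrow> real) \<Rightarrow> (real^'d \<Rightarrow> real) \<Rightarrow>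
     ('n::finite \<Rightarrow> real^'d) \<Rightarrow> ('n \<Rightarrow> real^'d \<Rightarrow> real) \<Rightarrow> bool" where
  "is_cardinal_family D \<kappa> s p \<phi> \<longleftrightarrow>
     (\<forall>j. \<phi> j \<in> vsk_span \<kappa> s p) \<and>
     (\<forall>h. \<forall>u\<in>D. vsk_interpolant \<kappa> s p h u = (\<Sum>j\<in>UNIV. h (p j) * \<phi> j u))"

(* For strictly positive definite \<kappa> and distinct nodes lying in D, such a family exists and is
   unique as a family of total functions, since \<phi> j lies in the span and the nodes determine
   its coefficients. *)
definition cardinal_functions ::
  "(real^'d) set \<Rightarrow> ((real^'d) \<times> real \<Rightarrow> (real^'d) \<times> real \<Rightarrow> real) \<Rightarrow> (real^'d \<Rightarrow> real) \<Rightarrow>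
     ('n::finite \<Rightarrow> real^'d) \<Rightarrow> 'n \<Rightarrow> real^'d \<Rightarrow> real" where
  "cardinal_functions D \<kappa> s p = (THE \<phi>. is_cardinal_family D \<kappa> s p \<phi>)"

definition lebesgue_function ::
  "(real^'d) set \<Rightarrow> ((real^'d) \<times> real \<Rightarrow> (real^'d) \<times> real \<Rightarrow> real) \<Rightarrow> (real^'d \<Rightarrow> real) \<Rightarrow>
     ('n::finite \<Rightarrow> real^'d) \<Rightarrow> real^'d \<Rightarrow> real" where
  "lebesgue_function D \<kappa> s p u = (\<Sum>j\<in>UNIV. \<bar>cardinal_functions D \<kappa> s p j u\<bar>)"

(* A real-valued supremum, meaningful only for f bounded on a nonempty set D.
   This is the case for g - P when g is continuous and D compact: a radial strictly positive
   definite kernel satisfies \<bar>\<kappa> x y\<bar> \<le> \<kappa> 0 0, so every interpolant is bounded. *)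
definition sup_norm_on :: "'a set \<Rightarrow> ('a \<Rightarrow> real) \<Rightarrow> real" where
  "sup_norm_on D f = (SUP u\<in>D. \<bar>f u\<bar>)"

end

(* The Lebesgue-function bound comes from linearity of interpolation:
   g - P_g = (g - P_gt) + P_(gt - g), and P_h is bounded pointwise by the maximum norm of the
   nodal values of h times the Lebesgue function. *)

theory Submission imports Defs begin

lemma strictly_positive_definite_sum_pos:
  assumes "strictly_positive_definite \<kappa>" and "finite X" and "x \<in> X" and "c x \<noteq> 0"
  shows "(\<Sum>x\<in>X. \<Sum>y\<in>X. c x * c y * \<kappa> x y) > 0"
proof -
  have "\<exists>x\<in>X. c x \<noteq> 0"
    using assms(3,4) by (rule bexI[rotated])
  then show ?thesis
    using assms(1,2) unfolding strictly_positive_definite_def by simp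
qed

text \<open>Transfers positivity from finite sets of points to families indexed by a finite type.
  Injectivity of \<open>q\<close> makes the coefficient of each point in \<open>range q\<close> well
  defined and turns the sum over points into a sum over indices.\<close>

lemma strictly_positive_definite_quadratic_form:
  fixes \<kappa> :: "'a \<Rightarrow> 'a \<Rightarrow> real" and q :: "'n::finite \<Rightarrow> 'a"
  assumes "strictly_positive_definite \<kappa>" and "inj q" and "\<exists>i. c i \<noteq> 0"
  shows "(\<Sum>i\<in>UNIV. \<Sum>j\<in>UNIV. c i * c j * \<kappa> (q i) (q j)) > 0"
proof -
  define c' where "c' x = c (inv q x)" for x
  have c': "c' (q i) = c i" for i
    by (simp add: c'_def assms(2))
  obtain i where "c' (q i) \<noteq> 0"
    using assms(3) c' by auto
  then have "(\<Sum>x\<in>range q. \<Sum>y\<in>range q. c' x * c' y * \<kappa> x y) > 0"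
    by (intro strictly_positive_definite_sum_pos[OF assms(1), where x = "q i"]) auto
  then show ?thesis
    by (simp add: sum.reindex[OF assms(2)] c')
qed

text \<open>Radiality makes the diagonal constant. On two distinct points the quadratic form with
  weights (1, 1) and (1, -1) is then 2 * \<open>\<kappa> 0 0\<close> plus or minus 2 *
  \<open>\<kappa> x y\<close>, and both values are positive.\<close>

lemma radial_strictly_positive_definite_bounded:
  fixes \<kappa> :: "'a::real_normed_vector \<Rightarrow> 'a \<Rightarrow> real"
  assumes "radial_kernel \<kappa>" and spd: "strictly_positive_definite \<kappa>"
  shows "\<bar>\<kappa> x y\<bar> \<le> \<kappa> 0 0"
proof -
  obtain \<phi> :: "real \<Rightarrow> real" where \<phi>: "\<And>x y. \<kappa> x y = \<phi> (norm (x - y))"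
    using assms(1) unfolding radial_kernel_def by blast
  have diag: "\<kappa> z z = \<kappa> 0 0" for z
    by (simp add: \<phi>)
  have sym: "\<kappa> y x = \<kappa> x y"
    using spd unfolding strictly_positive_definite_def by blast
  have pos: "(\<Sum>v\<in>{x, y}. \<Sum>w\<in>{x, y}. c v * c w * \<kappa> v w) > 0" if "c x \<noteq> 0" for c
    by (rule strictly_positive_definite_sum_pos[OF spd, where x = x]) (use that in auto)
  show ?thesis
  proof (cases "x = y")
    case True
    then show ?thesis
      \<comment> \<open>Here \<open>{x, y}\<close> is a singleton, so the form reduces to the
        diagonal value and gives \<open>\<kappa> 0 0 > 0\<close>.\<close>
      using pos[of "\<lambda>_. 1"] diag[of y] by simp
  next
    case False
    have "2 * \<kappa> 0 0 + 2 * \<kappa> x y > 0"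
      using pos[of "\<lambda>_. 1"] False by (simp add: diag[of x] diag[of y] sym)
    moreover have "2 * \<kappa> 0 0 - 2 * \<kappa> x y > 0"
      using pos[of "\<lambda>v. if v = x then 1 else - 1"] False by (simp add: diag[of x] diag[of y] sym)
    ultimately show ?thesis
      by linarith
  qed
qed

text \<open>A vector \<open>c\<close> in the kernel of the matrix makes the quadratic form
  \<open>c \<bullet> (?K *v c)\<close> vanish, so \<open>c = 0\<close> by strict positivity; a
  square matrix with trivial kernel is invertible. The augmented nodes are distinct because their
  first components are.\<close>

lemma invertible_vsk_matrix:
  fixes p :: "'n::finite \<Rightarrow> real^'d"
  assumes "strictly_positive_definite \<kappa>" and "inj p"
  shows "invertible (vsk_matrix \<kappa> s p)"
proof -
  let ?K = "vsk_matrix \<kappa> s p"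
  have "inj (\<lambda>i. (p i, s (p i)))"
    using assms(2) by (auto simp: inj_def)
  note pos = strictly_positive_definite_quadratic_form[OF assms(1) this]
  have "c = 0" if "?K *v c = 0" for c
  proof (rule ccontr)
    assume "c \<noteq> 0"
    then have "\<exists>i. c $ i \<noteq> 0"
      by (simp add: vec_eq_iff)
    then have "(\<Sum>i\<in>UNIV. \<Sum>j\<in>UNIV. c $ i * c $ j * ?K $ i $ j) > 0"
      using pos[of "\<lambda>i. c $ i"] by (simp add: vsk_matrix_def)
    also have "(\<Sum>i\<in>UNIV. \<Sum>j\<in>UNIV. c $ i * c $ j * ?K $ i $ j) = c \<bullet> (?K *v c)"
      by (simp add: inner_vec_def matrix_vector_mult_def sum_distrib_left mult_ac)
    finally show False
      using that by simp
  qed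
  then show ?thesis
    by (simp add: invertible_left_inverse matrix_left_invertible_ker)
qed

text \<open>Existence and uniqueness of the solution in one equivalence: it evaluates the definite
  description in \<open>vsk_coeffs\<close> and lets the matrix be cancelled.\<close>

lemma vsk_matrix_mult_iff:
  assumes "strictly_positive_definite \<kappa>" and "inj p"
  shows "vsk_matrix \<kappa> s p *v c = b \<longleftrightarrow> c = matrix_inv (vsk_matrix \<kappa> s p) *v b"
proof -
  let ?K = "vsk_matrix \<kappa> s p"
  have "?K ** matrix_inv ?K = mat 1 \<and> matrix_inv ?K ** ?K = mat 1"
    using invertible_vsk_matrix[OF assms] unfolding invertible_def matrix_inv_def
    by (rule someI_ex)
  then show ?thesis
    by (metis matrix_vector_mul_assoc matrix_vector_mul_lid)
qed

lemma vsk_coeffs_eq: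
  assumes "strictly_positive_definite \<kappa>" and "inj p"
  shows "vsk_coeffs \<kappa> s p h = matrix_inv (vsk_matrix \<kappa> s p) *v (\<chi> i. h (p i))"
  unfolding vsk_coeffs_def by (simp add: vsk_matrix_mult_iff[OF assms])

lemma vsk_span_at_node:
  assumes "strictly_positive_definite \<kappa>"
  shows "(\<Sum>j\<in>UNIV. a j * vsk_basis \<kappa> s p j (p i)) = (vsk_matrix \<kappa> s p *v (\<chi> j. a j)) $ i"
proof -
  \<comment> \<open>Basis function \<open>j\<close> at node \<open>i\<close> is the matrix entry (j,
    i); symmetry turns it into the entry (i, j) that the matrix product uses.\<close>
  have "\<kappa> x y = \<kappa> y x" for x y
    using assms unfolding strictly_positive_definite_def by blast
  then show ?thesis
    by (simp add: matrix_vector_mult_def vsk_basis_def vsk_matrix_def mult.commute)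
qed

lemma vsk_interpolant_at_node:
  assumes "strictly_positive_definite \<kappa>" and "inj p"
  shows "vsk_interpolant \<kappa> s p h (p i) = h (p i)"
proof -
  have "vsk_matrix \<kappa> s p *v vsk_coeffs \<kappa> s p h = (\<chi> i. h (p i))"
    by (simp add: vsk_matrix_mult_iff[OF assms] vsk_coeffs_eq[OF assms])
  then show ?thesis
    by (simp add: vsk_interpolant_def vsk_span_at_node[OF assms(1)])
qed

text \<open>Existence of the cardinal functions: the coefficients of the interpolant are the inverse
  matrix applied to the data, so collecting the factor of \<open>h (p j)\<close> leaves column
  \<open>j\<close> of the inverse as the coefficients of the j-th function.\<close>

lemma is_cardinal_family_matrix_inv:
  assumes "strictly_positive_definite \<kappa>" and "inj p"
  shows "is_cardinal_family D \<kappa> s p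
           (\<lambda>j u. \<Sum>i\<in>UNIV. matrix_inv (vsk_matrix \<kappa> s p) $ i $ j * vsk_basis \<kappa> s p i u)"
  unfolding is_cardinal_family_def
proof (intro conjI allI ballI)
  fix h u
  let ?B = "matrix_inv (vsk_matrix \<kappa> s p)"
  have "vsk_interpolant \<kappa> s p h u
      = (\<Sum>i\<in>UNIV. \<Sum>j\<in>UNIV. h (p j) * (?B $ i $ j * vsk_basis \<kappa> s p i u))"
    by (simp add: vsk_interpolant_def vsk_coeffs_eq[OF assms] matrix_vector_mult_def
        sum_distrib_left mult_ac)
  also have "\<dots> = (\<Sum>j\<in>UNIV. h (p j) * (\<Sum>i\<in>UNIV. ?B $ i $ j * vsk_basis \<kappa> s p i u))"
    by (subst sum.swap) (simp add: sum_distrib_left mult_ac)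
  finally show "vsk_interpolant \<kappa> s p h u
      = (\<Sum>j\<in>UNIV. h (p j) * (\<Sum>i\<in>UNIV. ?B $ i $ j * vsk_basis \<kappa> s p i u))" .
qed (auto simp: vsk_span_def)

text \<open>Interpolating the indicator of \<open>p j\<close> singles out \<open>\<phi> j\<close> in
  the cardinal expansion. The expansion is available at \<open>p i\<close> because the nodes lie in
  \<open>D\<close>.\<close>

lemma is_cardinal_family_at_node:
  assumes "strictly_positive_definite \<kappa>" and "inj p" and "range p \<subseteq> D"
    and "is_cardinal_family D \<kappa> s p \<phi>"
  shows "\<phi> j (p i) = (if i = j then 1 else 0)"
proof -
  let ?h = "\<lambda>v. if v = p j then 1 else 0 :: real"
  have "vsk_interpolant \<kappa> s p ?h (p i) = (\<Sum>k\<in>UNIV. ?h (p k) * \<phi> k (p i))"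
    using assms(3,4) unfolding is_cardinal_family_def by blast
  also have "\<dots> = (\<Sum>k\<in>UNIV. if k = j then \<phi> k (p i) else 0)"
    by (rule sum.cong) (auto simp: inj_eq[OF assms(2)])
  finally show ?thesis
    by (simp add: vsk_interpolant_at_node[OF assms(1,2)] inj_eq[OF assms(2)])
qed

text \<open>Values at the nodes are the matrix applied to the coefficients. Invertibility recovers
  the coefficients, so the functions agree everywhere, outside \<open>D\<close> too.\<close>

lemma vsk_span_eqI:
  assumes "strictly_positive_definite \<kappa>" and "inj p"
    and "f \<in> vsk_span \<kappa> s p" and "f' \<in> vsk_span \<kappa> s p" and "\<And>i. f (p i) = f' (p i)"
  shows "f = f'"
proof -
  obtain a a' where f: "f = (\<lambda>u. \<Sum>j\<in>UNIV. a j * vsk_basis \<kappa> s p j u)"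
    and f': "f' = (\<lambda>u. \<Sum>j\<in>UNIV. a' j * vsk_basis \<kappa> s p j u)"
    using assms(3,4) unfolding vsk_span_def by blast
  have "vsk_matrix \<kappa> s p *v (\<chi> j. a j) = vsk_matrix \<kappa> s p *v (\<chi> j. a' j)"
    using assms(5) by (simp add: vec_eq_iff f f' vsk_span_at_node[OF assms(1)])
  then have "(\<chi> j. a j) = (\<chi> j. a' j)"
    by (metis vsk_matrix_mult_iff[OF assms(1,2)])
  then show ?thesis
    by (simp add: f f' vec_eq_iff)
qed

text \<open>The definite description is meaningful: the inverse matrix supplies one family, and any
  other lies in the same span with the same Kronecker values at the nodes.\<close>

lemma is_cardinal_family_cardinal_functions:
  assumes "strictly_positive_definite \<kappa>" and "inj p" and "range p \<subseteq> D"
  shows "is_cardinal_family D \<kappa> s p (cardinal_functions D \<kappa> s p)"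
proof -
  define \<psi> where "\<psi> = (\<lambda>j u. \<Sum>i\<in>UNIV.
    matrix_inv (vsk_matrix \<kappa> s p) $ i $ j * vsk_basis \<kappa> s p i u)"
  have \<psi>: "is_cardinal_family D \<kappa> s p \<psi>"
    unfolding \<psi>_def by (rule is_cardinal_family_matrix_inv[OF assms(1,2)])
  have "\<phi> = \<psi>" if \<phi>: "is_cardinal_family D \<kappa> s p \<phi>" for \<phi>
  proof
    fix j
    show "\<phi> j = \<psi> j"
    proof (rule vsk_span_eqI[OF assms(1,2)])
      show "\<phi> j \<in> vsk_span \<kappa> s p" "\<psi> j \<in> vsk_span \<kappa> s p"
        using \<phi> \<psi> unfolding is_cardinal_family_def by simp_all
      show "\<phi> j (p i) = \<psi> j (p i)" for i
        by (simp add: is_cardinal_family_at_node[OF assms \<phi>] is_cardinal_family_at_node[OF assms \<psi>])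
    qed
  qed
  with \<psi> show ?thesis
    unfolding cardinal_functions_def by (rule theI)
qed

lemma abs_vsk_interpolant_diff_le:
  fixes p :: "'n::finite \<Rightarrow> real^'d"
  assumes "strictly_positive_definite \<kappa>" and "inj p" and "range p \<subseteq> D" and "u \<in> D"
  shows "\<bar>vsk_interpolant \<kappa> s p h u - vsk_interpolant \<kappa> s p h' u\<bar>
           \<le> infnorm ((\<chi> i. h (p i)) - (\<chi> i. h' (p i)) :: real^'n) * lebesgue_function D \<kappa> s p u"
proof -
  let ?v = "(\<chi> i. h (p i)) - (\<chi> i. h' (p i)) :: real^'n"
  let ?\<phi> = "cardinal_functions D \<kappa> s p"
  \<comment> \<open>In this form the interpolant is visibly linear in the data, with weights
    independent of \<open>h\<close>.\<close>
  have P: "vsk_interpolant \<kappa> s p h u = (\<Sum>j\<in>UNIV. h (p j) * ?\<phi> j u)" for h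
    using is_cardinal_family_cardinal_functions[OF assms(1-3)] assms(4)
    unfolding is_cardinal_family_def by blast
  have "vsk_interpolant \<kappa> s p h u - vsk_interpolant \<kappa> s p h' u = (\<Sum>j\<in>UNIV. ?v $ j * ?\<phi> j u)"
    by (simp add: P sum_subtractf left_diff_distrib)
  also have "\<bar>\<dots>\<bar> \<le> (\<Sum>j\<in>UNIV. \<bar>?v $ j * ?\<phi> j u\<bar>)"
    by (rule sum_abs)
  also have "\<dots> \<le> (\<Sum>j\<in>UNIV. infnorm ?v * \<bar>?\<phi> j u\<bar>)"
    unfolding abs_mult by (intro sum_mono mult_right_mono component_le_infnorm_cart) simp
  finally show ?thesis
    by (simp add: lebesgue_function_def sum_distrib_left)
qed

text \<open>The scaling function may be discontinuous, so boundedness is drawn from the kernel: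
  every basis function is at most \<open>\<kappa> 0 0\<close> in absolute value.\<close>

lemma bounded_vsk_interpolant:
  assumes "radial_kernel \<kappa>" and "strictly_positive_definite \<kappa>"
  shows "bounded (range (vsk_interpolant \<kappa> s p h))"
proof -
  have "\<bar>vsk_interpolant \<kappa> s p h u\<bar> \<le> (\<Sum>i\<in>UNIV. \<bar>vsk_coeffs \<kappa> s p h $ i\<bar> * \<kappa> 0 0)" for u
  proof -
    have "\<bar>vsk_interpolant \<kappa> s p h u\<bar>
        \<le> (\<Sum>i\<in>UNIV. \<bar>vsk_coeffs \<kappa> s p h $ i * vsk_basis \<kappa> s p i u\<bar>)"
      unfolding vsk_interpolant_def by (rule sum_abs)
    also have "\<dots> \<le> (\<Sum>i\<in>UNIV. \<bar>vsk_coeffs \<kappa> s p h $ i\<bar> * \<kappa> 0 0)"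
      unfolding abs_mult vsk_basis_def
      by (intro sum_mono mult_left_mono radial_strictly_positive_definite_bounded[OF assms]) simp
    finally show ?thesis .
  qed
  then show ?thesis
    unfolding bounded_iff by auto
qed

text \<open>A supremum of reals is known to dominate the values only when they are bounded above;
  this is where boundedness enters.\<close>

lemma abs_le_sup_norm_on:
  assumes "bounded (f ` D)" and "u \<in> D"
  shows "\<bar>f u\<bar> \<le> sup_norm_on D f"
proof -
  obtain B where "\<And>v. v \<in> D \<Longrightarrow> \<bar>f v\<bar> \<le> B"
    using assms(1) unfolding bounded_iff by auto
  then have "bdd_above ((\<lambda>v. \<bar>f v\<bar>) ` D)"
    by (auto intro!: bdd_aboveI)
  then show ?thesis
    unfolding sup_norm_on_def by (intro cSUP_upper assms(2))
qed

theorem mainTheorem2: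
  fixes D :: "(real^'d) set"
    and \<kappa> :: "(real^'d) \<times> real \<Rightarrow> (real^'d) \<times> real \<Rightarrow> real"
    and g gt :: "real^'d \<Rightarrow> real"
    and p :: "'n::finite \<Rightarrow> real^'d"
    and u :: "real^'d"
  assumes "radial_kernel \<kappa>"
    and "strictly_positive_definite \<kappa>"
    and "compact D"
    and "continuous_on D g"
    and "inj p"
    and "range p \<subseteq> D"
    and "u \<in> D"
  shows "\<bar>g u - vsk_interpolant \<kappa> gt p g u\<bar>
           \<le> sup_norm_on D (\<lambda>v. g v - vsk_interpolant \<kappa> gt p gt v)
             + infnorm ((\<chi> i. gt (p i)) - (\<chi> i. g (p i)) :: real^'n)
               * lebesgue_function D \<kappa> gt p u"
proof -
  let ?P = "vsk_interpolant \<kappa> gt p"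
  \<comment> \<open>The error is bounded on \<open>D\<close>, as its supremum norm requires:
    \<open>g\<close> by compactness and continuity, the interpolant by the kernel bound.\<close>
  have "bounded (g ` D)"
    by (intro compact_imp_bounded compact_continuous_image assms(3,4))
  moreover have "bounded (?P gt ` D)"
    by (rule bounded_subset[OF bounded_vsk_interpolant[OF assms(1,2)]]) blast
  ultimately have "bounded ((\<lambda>v. g v - ?P gt v) ` D)"
    by (rule bounded_minus_comp)
  then have "\<bar>g u - ?P gt u\<bar> \<le> sup_norm_on D (\<lambda>v. g v - ?P gt v)"
    by (rule abs_le_sup_norm_on[OF _ assms(7)])
  \<comment> \<open>The second term of the splitting: by linearity it is the interpolant of
    \<open>gt - g\<close> at \<open>u\<close>.\<close>
  moreover have "\<bar>?P gt u - ?P g u\<bar>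
      \<le> infnorm ((\<chi> i. gt (p i)) - (\<chi> i. g (p i)) :: real^'n) * lebesgue_function D \<kappa> gt p u"
    by (rule abs_vsk_interpolant_diff_le[OF assms(2,5,6,7)])
  ultimately show ?thesis
    by linarith
qed

end
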